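(* Let $p\ge 5$ and $q$ be primes satisfying the Wieferich condition $$q^{p-1}\equiv 1 \pmod{p^2}.$$ Then the reduction of $L(p,x)$ modulo $q$ splits into linear factors over $\mathbb{F}_q$.
   Context: For a prime $p\ge 5$ and $g$ a primitive root modulo $p^2$, define $$\eta_n=\sum_{j=0}^{p-2}\exp\left\{2\pi i\, g^{pj}(g^p+pn)/p^2\right\},\qquad L(p,x)=\prod_{n=1}^{p}(x-\eta_n).$$ The polynomial $L(p,x)$ has integer coefficients, so it can be reduced modulo $q$. *)

theory Defs
  imports
    Complex_Main
    "HOL-Number_Theory.Number_Theory"
    "HOL-Computational_Algebra.Computational_Algebra"
    "Berlekamp_Zassenhaus.Finite_Field"
begin

definition eta :: "nat \<Rightarrow> nat \<Rightarrow> nat \<Rightarrow> complex" where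
  "eta p g n =
     (\<Sum>j=0..p-2. exp (2 * of_real pi * \<i> * of_nat (g ^ (p * j) * (g ^ p + p * n)) / of_nat (p ^ 2)))"

definition L_poly :: "nat \<Rightarrow> nat \<Rightarrow> complex poly" where
  "L_poly p g = (\<Prod>n=1..p. [:- eta p g n, 1:])"

text \<open>The roots are listed with multiplicity. The zero polynomial is excluded.\<close>

definition splits_into_linear_factors :: "'a::field poly \<Rightarrow> bool" where
  "splits_into_linear_factors f \<longleftrightarrow>
     f \<noteq> 0 \<and> (\<exists>rs. f = smult (lead_coeff f) (\<Prod>r\<leftarrow>rs. [:- r, 1:]))"

end

theory Submission
  imports "HOL-Algebra.Algebraic_Closure_Type" Defs
begin

text \<open>Replace \<open>exp (2 \<pi> \<i> / p\<^sup>2)\<close> by an indeterminate \<open>t\<close>.  Modulo \<open>t\<^bsup>p\<^sup>2\<^esup> - 1\<close> the coefficients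
  of the resulting product are invariant under \<open>t \<mapsto> t\<^bsup>u\<^esup>\<close> for all units \<open>u\<close>, since this only permutes
  the periods; hence they are integers modulo \<open>\<Phi>(t) = 1 + t\<^bsup>p\<^esup> + \<dots> + t\<^bsup>p(p - 1)\<^esup>\<close>.  The same integer
  polynomial thus factors over every ring containing a root of \<open>\<Phi>\<close>: over \<open>\<complex>\<close> this gives \<open>L(p, x)\<close>,
  over the algebraic closure of \<open>F\<^sub>q\<close> its reduction.  The Wieferich condition
  says that \<open>q\<close> is a power of \<open>g\<^bsup>p\<^esup>\<close> modulo \<open>p\<^sup>2\<close>, so the Frobenius map permutes the
  terms of each period and the roots lie in \<open>F\<^sub>q\<close>.\<close>

section \<open>Periodic sums and products, and congruences written as divisibility\<close>

text \<open>Stated for any commutative monoid because it serves twice: for the sum forming a period,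
  cyclic in \<open>j\<close>, and for the product of the linear factors, cyclic in
  \<open>n\<close>.\<close>

lemma (in comm_monoid_set) periodic_shift:
  assumes "\<And>n::nat. h (n + p) = h n"
  shows "F h {w..<w + p} = F h {0..<p}"
proof (induction w)
  case (Suc w)
  show ?case
  proof (cases "p = 0")
    case False
    have "F h {Suc w..<Suc w + p} = F h {Suc w..<w + p} \<^bold>* h (w + p)"
      using False by (simp add: atLeastLessThanSuc commute)
    also have "\<dots> = h w \<^bold>* F h {Suc w..<w + p}"
      by (simp add: assms commute)
    also have "\<dots> = F h {w..<w + p}"
      using False by (simp add: atLeast_Suc_lessThan)
    finally show ?thesis using Suc by simp
  qed auto
qed auto

lemma dvd_diff_sum:
  fixes m :: "'a::comm_ring_1"
  assumes "\<And>i. i \<in> A \<Longrightarrow> m dvd f i - h i"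
  shows "m dvd sum f A - sum h A"
  using assms by (simp flip: sum_subtractf add: dvd_sum)

lemma dvd_diff_trans:
  fixes m :: "'a::comm_ring_1"
  assumes "m dvd a - b" "m dvd b - c"
  shows "m dvd a - c"
  using dvd_add[OF assms] by simp

lemma dvd_diff_sym:
  fixes m :: "'a::comm_ring_1"
  shows "m dvd a - b \<Longrightarrow> m dvd b - a"
  by (metis dvd_minus_iff minus_diff_eq)

lemma dvd_diff_prod:
  fixes m :: "'a::comm_ring_1"
  assumes "\<And>i. i \<in> A \<Longrightarrow> m dvd f i - h i"
  shows "m dvd prod f A - prod h A"
  using assms
proof (induction A rule: infinite_finite_induct)
  case (insert x A)
  have "prod f (insert x A) - prod h (insert x A) =
      (f x - h x) * prod f A + h x * (prod f A - prod h A)"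
    using insert by (simp add: algebra_simps)
  then show ?case using insert by (metis dvd_add dvd_mult dvd_mult2 insertI1 insertI2)
qed auto

section \<open>Substitution of monomials and arithmetic modulo t^N - 1\<close>

lemma pcompose_monom_monom:
  "pcompose (monom c i) (monom (1::'a::comm_semiring_1) u) = monom c (i * u)"
proof -
  have "monom c i = smult c (monom 1 1 ^ i)" by (simp add: monom_power smult_monom)
  moreover have "pcompose (monom 1 1) (monom (1::'a) u) = monom 1 u"
    by (simp add: monom_Suc pcompose_pCons)
  ultimately show ?thesis
    by (simp only: pcompose_smult pcompose_hom.hom_power) (simp add: monom_power smult_monom mult.commute)
qed

text \<open>With \<open>t\<close> the indeterminate this folds exponents of polynomials modulo
  \<open>N\<close>; with \<open>t ^ N = 1\<close> in a ring the divisor is 0 and it becomes an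
  equality of powers.\<close>

lemma cyclic_dvd_power_diff:
  fixes t :: "'a::comm_ring_1"
  assumes "[i = j] (mod N)"
  shows "t ^ N - 1 dvd t ^ i - t ^ j"
proof -
  have red: "t ^ N - 1 dvd t ^ i - t ^ (i mod N)" for i
  proof -
    have "t ^ N - 1 dvd (t ^ N) ^ (i div N) - 1 ^ (i div N)"
      by (metis dvd_triv_left power_diff_sumr2)
    then have "t ^ N - 1 dvd ((t ^ N) ^ (i div N) - 1) * t ^ (i mod N)" by simp
    also have "((t ^ N) ^ (i div N) - 1) * t ^ (i mod N) = t ^ i - t ^ (i mod N)"
      by (simp add: algebra_simps flip: power_mult power_add)
    finally show ?thesis .
  qed
  have "t ^ N - 1 dvd (t ^ i - t ^ (i mod N)) - (t ^ j - t ^ (j mod N))"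
    by (intro dvd_diff red)
  then show ?thesis using assms by (simp add: cong_def)
qed

lemma cyclic_dvd_monom_diff:
  assumes "[i = j] (mod N)"
  shows "monom (1::'a::comm_ring_1) N - 1 dvd monom c i - monom c j"
proof -
  have "monom 1 1 ^ N - 1 dvd (monom 1 1 ^ i - monom (1::'a) 1 ^ j)"
    by (rule cyclic_dvd_power_diff[OF assms])
  then have "monom 1 N - 1 dvd smult c (monom 1 i - monom (1::'a) j)"
    by (simp add: monom_power dvd_smult)
  then show ?thesis by (simp add: smult_diff_right smult_monom)
qed

text \<open>Gives uniqueness of representatives of degree below \<open>N\<close> modulo t^N - 1, so
  that congruent representatives can be compared coefficient by coefficient.\<close>

lemma cyclic_dvd_imp_0:
  fixes D :: "'a::idom poly"
  assumes "monom 1 N - 1 dvd D" "degree D < N"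
  shows "D = 0"
proof (rule ccontr)
  assume "D \<noteq> 0"
  then have "degree (monom 1 N - 1 :: 'a poly) \<le> degree D" using assms(1) dvd_imp_degree_le by blast
  moreover have "coeff (monom 1 N - 1 :: 'a poly) N = 1" using assms(2) by simp
  then have "N \<le> degree (monom 1 N - 1 :: 'a poly)" by (intro le_degree) simp
  ultimately show False using assms(2) by simp
qed

section \<open>The cyclotomic polynomial of order p^2 and unit-invariant polynomials\<close>

definition Phi_psq :: "nat \<Rightarrow> int poly" where
  "Phi_psq p = (\<Sum>j<p. monom 1 (p * j))"

lemma Phi_psq_dvd: "Phi_psq p dvd monom 1 (p\<^sup>2) - 1"
proof -
  have "(monom 1 p - 1) * Phi_psq p = (monom 1 p) ^ p - (1 :: int poly)"
    unfolding Phi_psq_def power_diff_1_eq by (simp add: monom_power)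
  then show ?thesis by (metis dvd_triv_right monom_power power2_eq_square power_one)
qed

lemma sum_lessThan_power2:
  fixes f :: "nat \<Rightarrow> 'a::comm_monoid_add"
  shows "sum f {..<p\<^sup>2} = (\<Sum>i<p. \<Sum>j<p. f (i + p * j))"
proof -
  have "sum f {..<p\<^sup>2} = (\<Sum>j<p. \<Sum>i<p. f (i + p * j))"
    using sum.nat_group[of f p p, symmetric]
    by (simp add: power2_eq_square mult.commute sum.shift_bounds_nat_ivl atLeast0LessThan
        sum.atLeastLessThan_shift_0[of f] add.commute)
  then show ?thesis by (subst (asm) sum.swap)
qed

text \<open>Modulo \<open>t\<^bsup>p\<^sup>2\<^esup> - 1\<close> the coefficients of \<open>A\<close> are constant on the orbits of the units on
  residues: the units, the nonzero multiples of \<open>p\<close>, and \<open>0\<close>.  The first orbit sums to \<open>0\<close> modulo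
  \<open>Phi_psq p\<close>, the second to \<open>-1\<close>.\<close>

lemma unit_invariant_imp_constant:
  fixes A :: "int poly"
  assumes p: "prime p"
    and inv: "\<And>u. coprime u p \<Longrightarrow> monom 1 (p\<^sup>2) - 1 dvd pcompose A (monom 1 u) - A"
  shows "\<exists>c. Phi_psq p dvd A - [:c:]"
proof -
  define N where "N = p\<^sup>2"
  let ?m = "monom 1 N - 1 :: int poly"
  have p1: "p > 1" using p prime_gt_1_nat by simp
  have pN: "p < N" "N > 0" using p1 by (simp_all add: N_def power2_eq_square)
  have fold_exists: "\<exists>D. degree D < N \<and> ?m dvd B - D" for B :: "int poly"
  proof (intro exI conjI)
    have "B = (\<Sum>i\<le>degree B. monom (coeff B i) i)" by (simp add: poly_as_sum_of_monoms)
    moreover have "?m dvd (\<Sum>i\<le>degree B. monom (coeff B i) i) - (\<Sum>i\<le>degree B. monom (coeff B i) (i mod N))"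
      by (intro dvd_diff_sum cyclic_dvd_monom_diff) (simp add: cong_def)
    ultimately show "?m dvd B - (\<Sum>i\<le>degree B. monom (coeff B i) (i mod N))" by simp
    show "degree (\<Sum>i\<le>degree B. monom (coeff B i) (i mod N)) < N"
      using pN by (intro degree_sum_less) (auto intro: le_less_trans[OF degree_monom_le])
  qed
  obtain D where D: "degree D < N" "?m dvd A - D" using fold_exists by blast
  define d where "d = coeff D"
  have Dsum: "D = (\<Sum>r<N. monom (d r) r)"
    using D(1) poly_as_sum_of_monoms'[of D "N - 1"] pN unfolding d_def
    by (metis Suc_diff_1 less_Suc_eq_le lessThan_Suc_atMost)
  \<comment> \<open>Substituting t^u into \<open>D\<close> and folding exponents gives
    \<open>?D'\<close>. It is congruent to \<open>D\<close> by way of \<open>A\<close>, and both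
    have degree below \<open>N\<close>, so they coincide. Multiplication by \<open>u\<close> is
    injective modulo \<open>N\<close>, so only \<open>r = s\<close> contributes at the exponent
    \<open>(u * s) mod N\<close>.\<close>
  have coeff_inv: "d ((u * s) mod N) = d s" if u: "coprime u p" and s: "s < N" for u s
  proof -
    let ?D' = "\<Sum>r<N. monom (d r) ((u * r) mod N)"
    have uN: "coprime u N" using u by (simp add: N_def)
    have "?m dvd A - pcompose A (monom 1 u)" unfolding N_def by (rule dvd_diff_sym[OF inv[OF u]])
    moreover have "?m dvd pcompose A (monom 1 u) - pcompose D (monom 1 u)"
    proof -
      have "pcompose ?m (monom 1 u) dvd pcompose (A - D) (monom 1 u)"
        using D(2) by (auto simp: dvd_def pcompose_mult)
      moreover have "pcompose ?m (monom 1 u) = monom 1 (N * u) - monom 1 0"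
        by (simp add: pcompose_diff pcompose_monom_monom pcompose_1)
      moreover have "?m dvd monom 1 (N * u) - monom 1 0"
        by (intro cyclic_dvd_monom_diff) (simp add: cong_def)
      ultimately have "?m dvd pcompose (A - D) (monom 1 u)" by (metis dvd_trans)
      then show ?thesis by (simp only: pcompose_diff)
    qed
    moreover have "?m dvd pcompose D (monom 1 u) - ?D'"
      by (subst Dsum, simp only: pcompose_sum pcompose_monom_monom)
        (intro dvd_diff_sum cyclic_dvd_monom_diff, simp add: cong_def mult.commute)
    moreover have "?m dvd D - A" by (rule dvd_diff_sym[OF D(2)])
    ultimately have "?m dvd D - ?D'" by (blast intro: dvd_diff_trans)
    moreover have "degree ?D' < N"
      using pN by (intro degree_sum_less) (auto intro: le_less_trans[OF degree_monom_le])
    then have "degree (D - ?D') < N" using D(1) by (simp add: degree_diff_less)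
    ultimately have "D - ?D' = 0" by (rule cyclic_dvd_imp_0)
    then have "coeff D ((u * s) mod N) = coeff ?D' ((u * s) mod N)" by simp
    also have "\<dots> = (\<Sum>r<N. if (u * r) mod N = (u * s) mod N then d r else 0)"
      by (simp add: coeff_sum)
    also have "\<dots> = (\<Sum>r<N. if r = s then d r else 0)"
    proof (intro sum.cong refl if_cong)
      fix r assume "r \<in> {..<N}"
      then show "((u * r) mod N = (u * s) mod N) = (r = s)"
        using cong_mult_lcancel_nat[OF uN, of r s] s by (simp add: cong_def)
    qed
    also have "\<dots> = d s" using s by simp
    finally show ?thesis by (simp add: d_def)
  qed
  \<comment> \<open>These exponents are themselves units, so they lie in the orbit of 1; in
    \<open>dp\<close> the unit \<open>j\<close> carries \<open>p\<close> to
    \<open>p * j\<close>.\<close>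
  have d1: "d (i + p * j) = d 1" if "0 < i" "i < p" "j < p" for i j
  proof -
    have "i + p * j < p + p * j" using that by simp
    also have "\<dots> = p * Suc j" by simp
    also have "\<dots> \<le> N" using that unfolding N_def power2_eq_square by (intro mult_le_mono) auto
    finally have lt: "i + p * j < N" .
    have "\<not> p dvd i + p * j" using that by (metis dvd_add_left_iff dvd_triv_left nat_dvd_not_less)
    then have "coprime (i + p * j) p" using p by (metis coprime_commute prime_imp_coprime)
    from coeff_inv[OF this, of 1] show ?thesis using lt pN p1 by simp
  qed
  have dp: "d (p * j) = d p" if "0 < j" "j < p" for j
  proof -
    have "coprime j p" using that p by (metis coprime_commute nat_dvd_not_less prime_imp_coprime)
    from coeff_inv[OF this, of p] show ?thesis
      using that pN p1 by (simp add: mult.commute N_def power2_eq_square)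
  qed
  define S where "S = (\<Sum>i\<in>{1..<p}. monom (d 1) i)"
  have "D = (\<Sum>i<p. \<Sum>j<p. monom (d (i + p * j)) (i + p * j))"
    using Dsum unfolding N_def sum_lessThan_power2 .
  also have "\<dots> = (\<Sum>j<p. monom (d (p * j)) (p * j)) + (\<Sum>i\<in>{1..<p}. \<Sum>j<p. monom (d (i + p * j)) (i + p * j))"
    using p1 by (simp add: lessThan_atLeast0 sum.atLeast_Suc_lessThan[of 0 p])
  also have "(\<Sum>i\<in>{1..<p}. \<Sum>j<p. monom (d (i + p * j)) (i + p * j)) =
      (\<Sum>i\<in>{1..<p}. \<Sum>j<p. monom (d 1) i * monom 1 (p * j))"
    using d1 by (intro sum.cong) (auto simp: mult_monom)
  also have "\<dots> = S * Phi_psq p"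
    by (simp add: S_def Phi_psq_def sum_product)
  also have "(\<Sum>j<p. monom (d (p * j)) (p * j)) = [:d 0:] + (\<Sum>j\<in>{1..<p}. monom (d (p * j)) (p * j))"
    using p1 by (simp add: lessThan_atLeast0 sum.atLeast_Suc_lessThan[of 0 p] monom_0)
  also have "(\<Sum>j\<in>{1..<p}. monom (d (p * j)) (p * j)) = (\<Sum>j\<in>{1..<p}. [:d p:] * monom 1 (p * j))"
    using dp by (intro sum.cong) (auto simp: smult_monom)
  also have "\<dots> = [:d p:] * (Phi_psq p - 1)"
    using p1 unfolding sum_distrib_left[symmetric] Phi_psq_def
    by (simp add: lessThan_atLeast0 sum.atLeast_Suc_lessThan[of 0 p] monom_0 one_pCons)
  finally have "D = [:d 0:] + [:d p:] * (Phi_psq p - 1) + S * Phi_psq p" .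
  \<comment> \<open>A rearrangement abstracted to variables; it exhibits \<open>d 0 - d p\<close> as
    the constant.\<close>
  moreover have "A' = a + b * (F - 1) + S * F \<Longrightarrow> A' - (a - b) = (b + S) * F" for A' a b F :: "int poly"
    by (simp add: algebra_simps)
  ultimately have "D - ([:d 0:] - [:d p:]) = ([:d p:] + S) * Phi_psq p" by blast
  then have "D - [:d 0 - d p:] = ([:d p:] + S) * Phi_psq p" by simp
  then have "Phi_psq p dvd D - [:d 0 - d p:]" by (metis dvd_triv_right)
  moreover have "Phi_psq p dvd A - D" using D(2) Phi_psq_dvd[of p] dvd_trans unfolding N_def by blast
  ultimately show ?thesis by (blast intro: dvd_diff_trans)
qed

section \<open>Periods and their product over an indeterminate root of unity\<close>

text \<open>Exponents are reduced modulo p^2 so that congruent \<open>m\<close> yield equal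
  polynomials, not just congruent ones.\<close>

definition period_poly :: "nat \<Rightarrow> nat \<Rightarrow> nat \<Rightarrow> int poly" where
  "period_poly p g m = (\<Sum>j<p - 1. monom 1 ((g ^ (p * j) * m) mod p\<^sup>2))"

definition L_generic :: "nat \<Rightarrow> nat \<Rightarrow> int poly poly" where
  "L_generic p g = (\<Prod>n=1..p. [:- period_poly p g (g ^ p + p * n), 1:])"

lemma period_poly_cong:
  assumes "[m = m'] (mod p\<^sup>2)"
  shows "period_poly p g m = period_poly p g m'"
  unfolding period_poly_def using assms
  by (intro sum.cong refl arg_cong[where f = "monom 1"]) (metis cong_def cong_scalar_left)

lemma dvd_pcompose_period_poly:
  "monom 1 (p\<^sup>2) - 1 dvd pcompose (period_poly p g m) (monom 1 u) - period_poly p g (u * m)"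
  unfolding period_poly_def pcompose_sum pcompose_monom_monom
proof (intro dvd_diff_sum cyclic_dvd_monom_diff)
  fix j
  have "[(g ^ (p * j) * m) mod p\<^sup>2 * u = (g ^ (p * j) * m) * u] (mod p\<^sup>2)"
    by (simp add: cong_def mod_mult_left_eq)
  then show "[(g ^ (p * j) * m) mod p\<^sup>2 * u = (g ^ (p * j) * (u * m)) mod p\<^sup>2] (mod p\<^sup>2)"
    by (simp add: cong_def mult_ac)
qed

lemma poly_period_poly:
  fixes t :: "'a::comm_ring_1"
  assumes "t ^ p\<^sup>2 = 1"
  shows "poly (map_poly of_int (period_poly p g m)) t = (\<Sum>j<p - 1. t ^ (g ^ (p * j) * m))"
proof -
  have "t ^ (i mod p\<^sup>2) = t ^ i" for i
    using cyclic_dvd_power_diff[of i "i mod p\<^sup>2" "p\<^sup>2" t] assms by (simp add: cong_def)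
  then show ?thesis
    by (simp add: period_poly_def of_int_hom.map_poly_hom_monom of_int_poly_hom.hom_sum poly_sum poly_monom)
qed

section \<open>The action of units modulo p^2 on the periods\<close>

context
  fixes p g :: nat
  assumes p: "prime p" and g: "residue_primroot (p\<^sup>2) g"
begin

lemma primroot_power_cong_1: "[g ^ (p * (p - 1)) = 1] (mod p\<^sup>2)"
proof -
  have "totient (p\<^sup>2) = p * (p - 1)"
    using totient_prime_power[OF p, of 2] by simp
  then show ?thesis
    using euler_theorem[of g "p\<^sup>2"] g by (simp add: residue_primroot_def coprime_commute)
qed

text \<open>The factor shifts the summation index by \<open>i\<close>, and by Euler's theorem the
  terms are periodic in \<open>j\<close> with period \<open>p - 1\<close>.\<close>

lemma period_poly_mult: "period_poly p g (g ^ (p * i) * m) = period_poly p g m"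
proof -
  define h where "h j = (monom 1 ((g ^ (p * j) * m) mod p\<^sup>2) :: int poly)" for j
  have h: "h (j + (p - 1)) = h j" for j
  proof -
    have "[g ^ (p * j) * m * g ^ (p * (p - 1)) = g ^ (p * j) * m * 1] (mod p\<^sup>2)"
      by (intro cong_mult cong_refl primroot_power_cong_1)
    moreover have "g ^ (p * (j + (p - 1))) * m = g ^ (p * j) * m * g ^ (p * (p - 1))"
      by (simp add: distrib_left power_add mult_ac)
    ultimately show ?thesis by (simp only: h_def cong_def mult_1_right)
  qed
  have "period_poly p g (g ^ (p * i) * m) = (\<Sum>j<p - 1. h (j + i))"
    unfolding period_poly_def h_def by (simp add: distrib_left power_add mult_ac)
  also have "\<dots> = sum h {i..<i + (p - 1)}"
    using sum.shift_bounds_nat_ivl[of h 0 i "p - 1"] by (simp add: lessThan_atLeast0 add.commute)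
  also have "\<dots> = sum h {0..<p - 1}" by (rule sum.periodic_shift[of h "p - 1", OF h])
  finally show ?thesis by (simp add: period_poly_def h_def lessThan_atLeast0)
qed

lemma primroot_generates:
  assumes "coprime u p"
  shows "\<exists>i. [g ^ i = u] (mod p\<^sup>2)"
proof -
  have N: "p\<^sup>2 > 1" using less_1_mult[OF prime_gt_1_nat prime_gt_1_nat, OF p p] by (simp add: power2_eq_square)
  have "coprime u (p\<^sup>2)" using assms by simp
  then have cop: "coprime (u mod p\<^sup>2) (p\<^sup>2)" using prime_gt_0_nat[OF p] by (subst coprime_mod_left_iff) auto
  have "u mod p\<^sup>2 \<noteq> 0"
  proof
    assume "u mod p\<^sup>2 = 0"
    then have "p\<^sup>2 dvd 1" using cop by (simp only: coprime_0_left_iff)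
    then show False using N by (metis nat_dvd_1_iff_1 less_irrefl)
  qed
  then have "u mod p\<^sup>2 \<in> totatives (p\<^sup>2)"
    using cop prime_gt_0_nat[OF p] by (auto simp: totatives_def intro!: less_imp_le)
  then obtain i where "u mod p\<^sup>2 = g ^ i mod p\<^sup>2"
    using residue_primroot_is_generator[OF N g] unfolding bij_betw_def by blast
  then show ?thesis by (metis cong_def)
qed

text \<open>If \<open>u\<close> is congruent to \<open>g ^ i\<close>, the order
  \<open>p * (p - 1)\<close> of \<open>g\<close> divides \<open>i * (p - 1)\<close>, which forces
  \<open>p dvd i\<close>. This turns the Wieferich condition into membership in the subgroup
  generated by \<open>g ^ p\<close>.\<close>

lemma primroot_pth_power_generates:
  assumes "[u ^ (p - 1) = 1] (mod p\<^sup>2)"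
  shows "\<exists>i. [g ^ (p * i) = u] (mod p\<^sup>2)"
proof -
  have p1: "p > 1" using prime_gt_1_nat[OF p] .
  have "coprime (u ^ (p - 1)) (p\<^sup>2)" using cong_imp_coprime[OF cong_sym[OF assms]] by simp
  then have "coprime u p" using p1 by simp
  then obtain i where i: "[g ^ i = u] (mod p\<^sup>2)" using primroot_generates by blast
  have "[g ^ (i * (p - 1)) = 1] (mod p\<^sup>2)"
    using cong_trans[OF cong_pow[OF i, of "p - 1"] assms] by (simp add: power_mult)
  then have "ord (p\<^sup>2) g dvd i * (p - 1)" by (simp only: ord_divides)
  moreover have "ord (p\<^sup>2) g = p * (p - 1)"
    using g totient_prime_power[OF p, of 2] by (simp add: residue_primroot_def)
  ultimately have "p dvd i" using p1 by simp
  then show ?thesis using i by (metis dvdE)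
qed

text \<open>Writing \<open>u = h (1 + p v)\<close> modulo \<open>p\<^sup>2\<close> with \<open>h\<close> a power of \<open>g ^ p\<close>, the factor \<open>1 + p v\<close>
  merely shifts the index \<open>n\<close> by \<open>v * g ^ p\<close>.\<close>

lemma period_poly_unit_shift:
  assumes u: "coprime u p"
  shows "\<exists>w. \<forall>n. period_poly p g (u * (g ^ p + p * n)) = period_poly p g (g ^ p + p * (n + w))"
proof -
  obtain i where i: "[g ^ i = u] (mod p\<^sup>2)" using primroot_generates[OF u] by blast
  \<comment> \<open>By Fermat, \<open>h\<close> agrees with \<open>g ^ i\<close>, hence with
    \<open>u\<close>, modulo \<open>p\<close>. Multiplying \<open>u\<close> by the inverse
    \<open>h'\<close> of \<open>h\<close> therefore gives 1 modulo \<open>p\<close>, which yields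
    \<open>v\<close>.\<close>
  define h where "h = g ^ (p * i)"
  have cg: "coprime g (p\<^sup>2)" using g by (simp add: residue_primroot_def coprime_commute)
  then have "coprime h (p\<^sup>2)" unfolding h_def by simp
  from cong_solve_coprime_nat[OF this] obtain h' where h': "[h * h' = 1] (mod p\<^sup>2)"
    unfolding One_nat_def by blast
  have iu: "[g ^ i = u] (mod p)" using i by (rule cong_dvd_modulus_nat) simp
  have "[h = g ^ i] (mod p)"
  proof -
    have "coprime (g ^ i) p" using cg by simp
    then have "\<not> p dvd g ^ i"
      using p coprime_common_divisor[of "g ^ i" p p] not_prime_unit by auto
    then have "[(g ^ i) ^ (p - 1) * g ^ i = 1 * g ^ i] (mod p)"
      by (intro cong_mult cong_refl fermat_theorem[OF p])
    moreover have "(g ^ i) ^ (p - 1) * g ^ i = h"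
      unfolding h_def using prime_gt_0_nat[OF p]
      by (simp add: mult.commute[of p] power_mult flip: power_Suc2)
    ultimately show ?thesis by simp
  qed
  then have hu: "[u * h' = h * h'] (mod p)"
    using iu by (meson cong_scalar_right cong_sym cong_trans)
  also have "[h * h' = 1] (mod p)" using h' by (rule cong_dvd_modulus_nat) simp
  finally have "[u * h' = 1] (mod p)" .
  \<comment> \<open>Over the naturals, congruence to 1 yields the form \<open>1 + p * v\<close> only
    after the value 0, possible for modulus 1, is excluded.\<close>
  moreover have "u * h' \<noteq> 0"
    using calculation prime_gt_1_nat[OF p] by (metis cong_0_1_nat cong_sym less_irrefl)
  ultimately obtain v where v: "u * h' = 1 + p * v"
    using cong_to_1'_nat[of "u * h'" p] by (auto simp: mult.commute)
  have "u * (h * h') = h * (1 + p * v)" by (simp only: v[symmetric] mult_ac)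
  then have "[u = h * (1 + p * v)] (mod p\<^sup>2)"
    using cong_sym[OF cong_scalar_left[OF h', of u]] by (simp only: mult_1_right)
  then have 1: "period_poly p g (u * (g ^ p + p * n)) = period_poly p g (h * ((1 + p * v) * (g ^ p + p * n)))" for n
    by (intro period_poly_cong) (metis cong_scalar_right mult.assoc)
  have 2: "period_poly p g ((1 + p * v) * (g ^ p + p * n)) = period_poly p g (g ^ p + p * (n + v * g ^ p))" for n
  proof (intro period_poly_cong)
    have "(1 + p * v) * (g ^ p + p * n) = (g ^ p + p * (n + v * g ^ p)) + p\<^sup>2 * (v * n)"
      by (simp add: algebra_simps power2_eq_square)
    then show "[(1 + p * v) * (g ^ p + p * n) = g ^ p + p * (n + v * g ^ p)] (mod p\<^sup>2)"
      by (simp only: cong_def mod_mult_self2)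
  qed
  show ?thesis using 1 2 period_poly_mult unfolding h_def by metis
qed

text \<open>Modulo t^(p^2) - 1, substituting t^u turns factor \<open>n\<close> into factor
  \<open>n + w\<close> with \<open>w\<close> independent of \<open>n\<close>. The factors have
  period \<open>p\<close> in \<open>n\<close>, so the product over a full period is
  preserved.\<close>

lemma L_generic_unit_invariant:
  assumes u: "coprime u p"
  shows "monom 1 (p\<^sup>2) - 1 dvd pcompose (coeff (L_generic p g) k) (monom 1 u) - coeff (L_generic p g) k"
proof -
  interpret \<sigma>: map_poly_comm_ring_hom "\<lambda>q :: int poly. pcompose q (monom 1 u)" ..
  obtain w where w: "\<And>n. period_poly p g (u * (g ^ p + p * n)) = period_poly p g (g ^ p + p * (n + w))"
    using period_poly_unit_shift[OF u] by blast
  define h where "h n = [:- period_poly p g (g ^ p + p * n), 1:]" for n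
  have h: "h (n + p) = h n" for n
  proof -
    have "g ^ p + p * (n + p) = (g ^ p + p * n) + p\<^sup>2"
      by (simp add: algebra_simps power2_eq_square)
    then have "[g ^ p + p * (n + p) = g ^ p + p * n] (mod p\<^sup>2)"
      by (simp only: cong_def mod_add_self2)
    then show ?thesis unfolding h_def by (simp add: period_poly_cong)
  qed
  have ivl: "prod f {1..p} = prod f {1..<1 + p}" for f :: "nat \<Rightarrow> int poly poly"
    by (simp add: atLeastLessThanSuc_atLeastAtMost)
  have "(\<Prod>n=1..p. h (n + w)) = prod h {1 + w..<1 + w + p}"
    using prod.shift_bounds_nat_ivl[of h 1 w "1 + p"] by (simp only: ivl) (simp add: add_ac)
  also have "\<dots> = prod h {1..p}"
    unfolding ivl prod.periodic_shift[of h p, OF h] ..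
  finally have shift: "(\<Prod>n=1..p. h (n + w)) = L_generic p g" by (simp add: L_generic_def h_def)
  have "map_poly (\<lambda>q. pcompose q (monom 1 u)) (L_generic p g) =
      (\<Prod>n=1..p. [:- pcompose (period_poly p g (g ^ p + p * n)) (monom 1 u), 1:])"
    unfolding L_generic_def \<sigma>.hom_prod
    by (simp add: pcompose_hom.map_poly_pCons_hom pcompose_uminus pcompose_1)
  moreover have "[:monom 1 (p\<^sup>2) - 1:] dvd
      (\<Prod>n=1..p. [:- pcompose (period_poly p g (g ^ p + p * n)) (monom 1 u), 1:]) - (\<Prod>n=1..p. h (n + w))"
  proof (intro dvd_diff_prod)
    fix n
    have "monom 1 (p\<^sup>2) - 1 dvd - (pcompose (period_poly p g (g ^ p + p * n)) (monom 1 u)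
        - period_poly p g (g ^ p + p * (n + w)))"
      unfolding dvd_minus_iff w[symmetric] by (rule dvd_pcompose_period_poly)
    then show "[:monom 1 (p\<^sup>2) - 1:] dvd
        [:- pcompose (period_poly p g (g ^ p + p * n)) (monom 1 u), 1:] - h (n + w)"
      by (auto simp: h_def const_poly_dvd_iff coeff_pCons split: nat.split)
  qed
  ultimately have "[:monom 1 (p\<^sup>2) - 1:] dvd
      map_poly (\<lambda>q. pcompose q (monom 1 u)) (L_generic p g) - L_generic p g"
    unfolding shift by simp
  then show ?thesis by (simp add: const_poly_dvd_iff coeff_map_poly)
qed

lemma L_generic_specializes:
  "\<exists>P :: int poly. \<forall>k. Phi_psq p dvd coeff (L_generic p g) k - [:coeff P k:]"
proof -
  let ?F = "L_generic p g"
  have "\<exists>c. Phi_psq p dvd coeff ?F k - [:c:]" for k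
    by (intro unit_invariant_imp_constant[OF p] L_generic_unit_invariant)
  then obtain c where c: "\<And>k. Phi_psq p dvd coeff ?F k - [:c k:]" by metis
  \<comment> \<open>The choices \<open>c k\<close> need not vanish for large \<open>k\<close>; the
    sum stops at the degree, beyond which the coefficients of \<open>?F\<close> are 0.\<close>
  define P where "P = (\<Sum>k\<le>degree ?F. monom (c k) k)"
  have "coeff P k = (if k \<le> degree ?F then c k else 0)" for k
    by (simp add: P_def coeff_sum)
  then have "Phi_psq p dvd coeff ?F k - [:coeff P k:]" for k
    using c by (cases "k \<le> degree ?F") (simp_all add: coeff_eq_0)
  then show ?thesis by blast
qed

end

section \<open>Specialization at a root of \<open>Phi_psq p\<close>\<close>

text \<open>Evaluation at \<open>t\<close> kills every multiple of \<open>Phi_psq p\<close>: it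
  sends the coefficients of \<open>L_generic p g\<close> to those of \<open>P\<close> and, since
  also \<open>t ^ p\<^sup>2 = 1\<close>, the period polynomials to the periods of \<open>t\<close>.
  One \<open>P\<close> thus serves all rings.\<close>

lemma map_poly_L_generic:
  fixes t :: "'a::comm_ring_1"
  assumes P: "\<And>k. Phi_psq p dvd coeff (L_generic p g) k - [:coeff P k:]"
    and t: "poly (map_poly of_int (Phi_psq p)) t = 0"
  shows "map_poly of_int P = (\<Prod>n=1..p. [:- (\<Sum>j<p - 1. t ^ (g ^ (p * j) * (g ^ p + p * n))), 1:])"
proof -
  define ev where "ev A = poly (map_poly of_int A) t" for A :: "int poly"
  interpret ev: comm_ring_hom ev
    by unfold_locales (simp_all add: ev_def of_int_poly_hom.hom_add of_int_poly_hom.hom_mult)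
  interpret evp: map_poly_comm_ring_hom ev ..
  have ev0: "ev B = 0" if "Phi_psq p dvd B" for B
    using that t by (auto simp: ev_def dvd_def of_int_poly_hom.hom_mult)
  have "ev (monom 1 (p\<^sup>2) - 1) = 0" by (intro ev0 Phi_psq_dvd)
  then have t1: "t ^ p\<^sup>2 = 1"
    by (simp add: ev_def of_int_poly_hom.hom_minus of_int_hom.map_poly_hom_monom poly_monom)
  have "map_poly of_int P = map_poly ev (L_generic p g)"
  proof (rule poly_eqI)
    fix k
    have "ev (coeff (L_generic p g) k) = ev [:coeff P k:]"
      using ev0[OF P[of k]] by (simp add: ev.hom_minus)
    then show "coeff (map_poly of_int P) k = coeff (map_poly ev (L_generic p g)) k"
      by (simp add: coeff_map_poly ev_def of_int_hom.map_poly_pCons_hom)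
  qed
  also have "\<dots> = (\<Prod>n=1..p. [:- ev (period_poly p g (g ^ p + p * n)), 1:])"
    unfolding L_generic_def evp.hom_prod by (simp add: ev.map_poly_pCons_hom ev.hom_uminus)
  finally show ?thesis unfolding ev_def poly_period_poly[OF t1] .
qed

lemma poly_Phi_psq:
  "poly (map_poly of_int (Phi_psq p)) (t :: 'a::comm_ring_1) = (\<Sum>j<p. (t ^ p) ^ j)"
  by (simp add: Phi_psq_def of_int_poly_hom.hom_sum poly_sum poly_monom power_mult)

lemma poly_Phi_psq_eq_0:
  fixes t :: "'a::idom"
  assumes "t ^ p\<^sup>2 = 1" "t ^ p \<noteq> 1"
  shows "poly (map_poly of_int (Phi_psq p)) t = 0"
proof -
  have "(t ^ p - 1) * (\<Sum>j<p. (t ^ p) ^ j) = (t ^ p) ^ p - 1" by (rule power_diff_1_eq[symmetric])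
  also have "\<dots> = 0" using assms(1) by (simp add: power2_eq_square power_mult)
  finally show ?thesis using assms(2) by (simp add: poly_Phi_psq)
qed

lemma exp_two_pi_i_over_n_neq_1:
  fixes n :: nat
  assumes "n > 1"
  shows "exp (2 * of_real pi * \<i> / of_nat n) \<noteq> (1 :: complex)"
proof -
  have "inj_on (\<lambda>k. cis (2 * pi * real k / real n)) {..<n}"
    using bij_betw_roots_unity[of n] assms by (simp add: bij_betw_def)
  from inj_onD[OF this, of 1 0] assms have "cis (2 * pi / real n) \<noteq> 1" by auto
  then show ?thesis by (simp add: cis_conv_exp mult_ac)
qed

text \<open>The coefficient 1 at exponent \<open>p\<close> survives in every characteristic, so the
  image is not constant.\<close>

lemma Phi_psq_has_root:
  assumes "p > 1"
  shows "\<exists>t :: 'a::alg_closed_field. poly (map_poly of_int (Phi_psq p)) t = 0"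
proof (rule alg_closed_imp_poly_has_root)
  have "coeff (Phi_psq p) p = (\<Sum>j<p. if j = 1 then 1 else 0)"
    unfolding Phi_psq_def coeff_sum using assms by (intro sum.cong) auto
  also have "\<dots> = 1" using assms by simp
  finally have "coeff (map_poly of_int (Phi_psq p) :: 'a poly) p \<noteq> 0" by (simp add: coeff_map_poly)
  then have "p \<le> degree (map_poly of_int (Phi_psq p) :: 'a poly)" by (rule le_degree)
  then show "degree (map_poly of_int (Phi_psq p) :: 'a poly) > 0" using assms by simp
qed

section \<open>Frobenius and descent to the finite field\<close>

text \<open>The embedded field already supplies \<open>CARD('a)\<close> roots of
  X^\<open>CARD('a)\<close> - X, which is as many as its degree allows.\<close>

lemma alg_closure_Frobenius_fixed:
  fixes x :: "'a::finite_field alg_closure"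
  assumes "x ^ CARD('a) = x"
  shows "x \<in> range to_ac"
proof -
  define f where "f = (monom 1 CARD('a) - monom 1 1 :: 'a alg_closure poly)"
  have card1: "CARD('a) > 1"
    using card_mono[of UNIV "{0, 1 :: 'a}"] by simp
  have "coeff f CARD('a) = 1" using card1 by (simp add: f_def)
  then have f0: "f \<noteq> 0" by auto
  have "degree f \<le> CARD('a)" unfolding f_def
    using card1 by (intro degree_diff_le order_trans[OF degree_monom_le]) auto
  then have "card {y. poly f y = 0} \<le> card (range to_ac :: 'a alg_closure set)"
    using card_poly_roots_bound[OF f0] by (simp add: card_image inj_to_ac)
  moreover have "range to_ac \<subseteq> {y. poly f y = 0}"
    by (auto simp: f_def poly_monom finite_field_power_card_eq_same simp flip: to_ac_power)
  ultimately have "range to_ac = {y. poly f y = 0}"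
    using card_seteq[OF poly_roots_finite[OF f0]] by blast
  then show ?thesis using assms by (simp add: f_def poly_monom)
qed

text \<open>In characteristic \<open>q\<close> the power distributes over the sum and multiplies
  \<open>m\<close> by \<open>q\<close>; as \<open>q\<close> is a power of \<open>g ^ p\<close>
  modulo p^2, this only permutes the terms.\<close>

lemma period_Frobenius_fixed:
  fixes t :: "'a::comm_ring_1"
  assumes p: "prime p" and g: "residue_primroot (p\<^sup>2) g" and q: "prime q" "CHAR('a) = q"
    and wieferich: "[q ^ (p - 1) = 1] (mod p\<^sup>2)" and t: "t ^ p\<^sup>2 = 1"
  shows "(\<Sum>j<p - 1. t ^ (g ^ (p * j) * m)) ^ q = (\<Sum>j<p - 1. t ^ (g ^ (p * j) * m))"
proof -
  obtain i where i: "[g ^ (p * i) = q] (mod p\<^sup>2)"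
    using primroot_pth_power_generates[OF p g wieferich] by blast
  have "(\<Sum>j<p - 1. t ^ (g ^ (p * j) * m)) ^ q = (\<Sum>j<p - 1. t ^ (g ^ (p * j) * (q * m)))"
    using q by (simp add: freshmans_dream_sum mult_ac flip: power_mult)
  also have "\<dots> = poly (map_poly of_int (period_poly p g (q * m))) t"
    by (rule poly_period_poly[OF t, symmetric])
  also have "period_poly p g (q * m) = period_poly p g (g ^ (p * i) * m)"
    by (intro period_poly_cong cong_scalar_right cong_sym[OF i])
  also have "\<dots> = period_poly p g m" by (rule period_poly_mult[OF p g])
  also have "poly (map_poly of_int \<dots>) t = (\<Sum>j<p - 1. t ^ (g ^ (p * j) * m))"
    by (rule poly_period_poly[OF t])
  finally show ?thesis .
qed

theorem theorem4:
  fixes p q g :: nat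
  assumes "prime p" and "p \<ge> 5"
    and "prime q" and "CARD('q::prime_card) = q"
    and "residue_primroot (p ^ 2) g"
    and "[q ^ (p - 1) = 1] (mod p ^ 2)"
  shows "\<exists>P :: int poly. map_poly of_int P = L_poly p g \<and>
           splits_into_linear_factors (map_poly of_int P :: 'q mod_ring poly)"
proof -
  obtain P where P: "\<And>k. Phi_psq p dvd coeff (L_generic p g) k - [:coeff P k:]"
    using L_generic_specializes[OF assms(1,5)] by blast
  have p1: "p > 1" using assms(2) by simp
  have "map_poly of_int P = L_poly p g"
  proof -
    define t where "t = exp (2 * of_real pi * \<i> / of_nat (p\<^sup>2) :: complex)"
    have pow: "t ^ k = exp (2 * of_real pi * \<i> * of_nat k / of_nat (p\<^sup>2))" for k
      unfolding t_def by (simp add: mult_ac flip: exp_of_nat_mult)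
    have "t ^ p = exp (2 * of_real pi * \<i> / of_nat p)"
      unfolding pow using p1 by (simp add: power2_eq_square)
    then have "t ^ p \<noteq> 1" using exp_two_pi_i_over_n_neq_1[OF p1] by simp
    moreover have "t ^ p\<^sup>2 = 1" unfolding pow using p1 by simp
    ultimately have "poly (map_poly of_int (Phi_psq p)) t = 0" by (intro poly_Phi_psq_eq_0)
    from map_poly_L_generic[OF P this]
    have "map_poly of_int P = (\<Prod>n=1..p. [:- (\<Sum>j<p - 1. t ^ (g ^ (p * j) * (g ^ p + p * n))), 1:])" .
    \<comment> \<open>\<open>eta\<close> includes its upper index \<open>p - 2\<close>; with
      truncated subtraction the ranges agree because \<open>p > 1\<close>.\<close>
    moreover have "{..<p - 1} = {0..p - 2}" using p1 by auto
    ultimately show ?thesis by (simp only: L_poly_def eta_def pow)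
  qed
  moreover have "splits_into_linear_factors (map_poly of_int P :: 'q mod_ring poly)"
  proof -
    let ?P = "map_poly of_int P :: 'q mod_ring poly"
    interpret ac: map_poly_inj_comm_ring_hom "to_ac :: 'q mod_ring \<Rightarrow> _"
      by unfold_locales simp_all
    obtain t :: "'q mod_ring alg_closure" where t: "poly (map_poly of_int (Phi_psq p)) t = 0"
      using Phi_psq_has_root[OF p1] by blast
    have "(t ^ p) ^ p - 1 = 0" unfolding power_diff_1_eq using t by (simp add: poly_Phi_psq)
    then have t1: "t ^ p\<^sup>2 = 1" by (simp add: power2_eq_square power_mult)
    define e where "e n = (\<Sum>j<p - 1. t ^ (g ^ (p * j) * (g ^ p + p * n)))" for n
    \<comment> \<open>\<open>of_ac\<close> inverts \<open>to_ac\<close> only on its range; that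
      \<open>e n\<close> lies there follows from its invariance under the \<open>q\<close>-th
      power.\<close>
    define r where "r n = of_ac (e n)" for n
    have "e n ^ q = e n" for n
      unfolding e_def using assms by (intro period_Frobenius_fixed t1) simp_all
    then have r: "to_ac (r n) = e n" for n
      unfolding r_def using assms(4) by (intro to_ac_of_ac alg_closure_Frobenius_fixed) simp
    \<comment> \<open>The factorization is established in the closure and pulled back along the
      injective \<open>to_ac\<close>.\<close>
    have "map_poly to_ac ?P = map_poly of_int P"
      by (rule poly_eqI) (simp add: coeff_map_poly)
    also have "\<dots> = (\<Prod>n=1..p. [:- to_ac (r n), 1:])"
      unfolding r e_def by (rule map_poly_L_generic[OF P t])
    also have "\<dots> = map_poly to_ac (\<Prod>n=1..p. [:- r n, 1:])"
      by (simp add: ac.hom_prod ac.base.map_poly_pCons_hom)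
    finally have P_eq: "?P = (\<Prod>n=1..p. [:- r n, 1:])" by (simp only: ac.eq_iff)
    then have "lead_coeff ?P = 1" by (simp add: lead_coeff_prod)
    moreover have "(\<Prod>n=1..p. [:- r n, 1:]) = (\<Prod>x\<leftarrow>map r [1..<Suc p]. [:- x, 1:])"
      using prod.distinct_set_conv_list[of "[1..<Suc p]" "\<lambda>n. [:- r n, 1:]"]
      by (simp only: distinct_upt set_upt atLeastLessThanSuc_atLeastAtMost map_map o_def)
    ultimately have "?P = smult (lead_coeff ?P) (\<Prod>x\<leftarrow>map r [1..<Suc p]. [:- x, 1:])"
      using P_eq by simp
    moreover have "?P \<noteq> 0" using \<open>lead_coeff ?P = 1\<close> by (metis coeff_0 zero_neq_one)
    ultimately show ?thesis unfolding splits_into_linear_factors_def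
      by (intro conjI exI[of _ "map r [1..<Suc p]"])
  qed
  ultimately show ?thesis by blast
qed

end
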